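(* Let $S^{(\mathrm{val})}_{m_{\mathrm{val}}}=\{(x_1,y_1),\dots,(x_{m_{\mathrm{val}}},y_{m_{\mathrm{val}}})\}$ be a validation dataset generated by i.i.d. draws according to a probability distribution $\mathbb{P}_{(X,Y)}$ on $\mathcal{X}\times\mathcal{Y}$, and let $\mathcal{F}_{\mathrm{val}}$ be a finite set of models $f:\mathcal{X}\to\mathcal{Y}$ that is independent of $S^{(\mathrm{val})}_{m_{\mathrm{val}}}$. Let $\kappa_{f,i}=\mathcal{R}[f]-\mathcal{L}(f(x_i),y_i)$ for $(x_i,y_i)\in S^{(\mathrm{val})}_{m_{\mathrm{val}}}$. Suppose that $\mathbb{E}[\kappa_{f,i}^2]\le\gamma^2$ and $|\kappa_{f,i}|\le C$ almost surely, for all $(f,i)\in\mathcal{F}_{\mathrm{val}}\times\{1,\dots,m_{\mathrm{val}}\}$. Then, for any $\delta>0$, with probability at least $1-\delta$, the following holds for all $f\in\mathcal{F}_{\mathrm{val}}$: $$\mathcal{R}[f]\le \mathcal{R}_{S^{(\mathrm{val})}_{m_{\mathrm{val}}}}[f]+\frac{2C\ln\left(\frac{|\mathcal{F}_{\mathrm{val}}|}{\delta}\right)}{3m_{\mathrm{val}}}+\sqrt{\frac{2\gamma^2\ln\left(\frac{|\mathcal{F}_{\mathrm{val}}|}{\delta}\right)}{m_{\mathrm{val}}}}.$$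
   Context: $\mathcal{L}$ is a real-valued loss function. $\mathcal{R}[f]=\mathbb{E}_{(x,y)\sim\mathbb{P}_{(X,Y)}}[\mathcal{L}(f(x),y)]$ is the expected risk, and for a finite dataset $T=\{(x_i,y_i)\}_{i=1}^{N}$, $\mathcal{R}_T[f]=\frac1N\sum_{i=1}^N\mathcal{L}(f(x_i),y_i)$ is the empirical risk. The set $\mathcal{F}_{\mathrm{val}}$ may depend on a training dataset $S$ that is independent of the validation dataset $S^{(\mathrm{val})}_{m_{\mathrm{val}}}$, but not on the validation dataset itself; thus it may be regarded as a fixed, nonempty, finite set of functions, and the probability is over the draw of the validation dataset. *)

theory Defs
  imports "HOL-Probability.Probability"
begin

definition expected_risk ::
  "('y \<Rightarrow> 'y \<Rightarrow> real) \<Rightarrow> ('x \<times> 'y) measure \<Rightarrow> ('x \<Rightarrow> 'y) \<Rightarrow> real" where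
  "expected_risk L P f = (\<integral>(x, y). L (f x) y \<partial>P)"

text \<open>A dataset of size \<open>N\<close> is a family of pairs indexed by \<open>{1..N}\<close>, so repeated draws are
  counted with multiplicity; values at other indices are irrelevant.\<close>

definition empirical_risk ::
  "('y \<Rightarrow> 'y \<Rightarrow> real) \<Rightarrow> nat \<Rightarrow> (nat \<Rightarrow> 'x \<times> 'y) \<Rightarrow> ('x \<Rightarrow> 'y) \<Rightarrow> real" where
  "empirical_risk L N T f = (1 / real N) * (\<Sum>i = 1..N. L (f (fst (T i))) (snd (T i)))"

definition kappa ::
  "('y \<Rightarrow> 'y \<Rightarrow> real) \<Rightarrow> ('x \<times> 'y) measure \<Rightarrow> (nat \<Rightarrow> 'x \<times> 'y) \<Rightarrow> ('x \<Rightarrow> 'y) \<Rightarrow> nat \<Rightarrow> real" where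
  "kappa L P T f i = expected_risk L P f - L (f (fst (T i))) (snd (T i))"

text \<open>The draws \<open>Z i\<close> live on an arbitrary probability space \<open>\<Omega>\<close>. The predicate
  \<open>prob_space.indep_vars\<close> also requires each \<open>Z i\<close> to be measurable.\<close>

definition iid_draws ::
  "'w measure \<Rightarrow> ('x \<times> 'y) measure \<Rightarrow> nat \<Rightarrow> (nat \<Rightarrow> 'w \<Rightarrow> 'x \<times> 'y) \<Rightarrow> bool" where
  "iid_draws \<Omega> P m Z \<longleftrightarrow>
     prob_space.indep_vars \<Omega> (\<lambda>_. P) Z {1..m} \<and> (\<forall>i\<in>{1..m}. distr \<Omega> P (Z i) = P)"

end

theory Submission
  imports Defs
begin

text \<open>Each \<open>\<kappa>\<^sub>f\<^sub>,\<^sub>i\<close> is centred, so for fixed \<open>f\<close> Bernstein's inequality bounds the probability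
  that \<open>\<Sum>\<^sub>i \<kappa>\<^sub>f\<^sub>,\<^sub>i\<close> exceeds \<open>C t / 3 + sqrt (2 m \<gamma>\<^sup>2 t)\<close> by \<open>exp (- t)\<close>. With
  \<open>t = ln (card F / \<delta>)\<close> a union bound over \<open>F\<close> gives total failure probability at most \<open>\<delta>\<close>.
  Solving for \<open>t\<close> exactly, rather than through the usual quadratic form of Bernstein's
  inequality, even gives half of the claimed linear term.\<close>

text \<open>After the factor 2, each of the remaining \<open>k\<close> factors of
  \<open>fact (k + 2)\<close> is at least 3. This is the origin of the constant 3 in Bernstein's
  inequality.\<close>

lemma two_mult_three_power_le_fact: "2 * 3 ^ k \<le> (fact (k + 2) :: real)"
proof (induction k)
  case (Suc k)
  have "2 * 3 ^ Suc k = 3 * (2 * 3 ^ k :: real)" by simp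
  also have "\<dots> \<le> (real k + 3) * fact (k + 2)"
    using Suc by (intro mult_mono) auto
  also have "\<dots> = fact (Suc k + 2)" by (simp add: algebra_simps)
  finally show ?case .
qed simp

text \<open>From the quadratic term on, the exponential series is dominated termwise by a geometric
  series with ratio \<open>b / 3\<close>, which converges because \<open>b < 3\<close>.\<close>

lemma exp_le_Bernstein:
  fixes y b :: real
  assumes "\<bar>y\<bar> \<le> b" "b < 3"
  shows "exp y \<le> 1 + y + y\<^sup>2 / (2 * (1 - b / 3))"
proof -
  have b: "0 \<le> b" using assms by linarith
  have sums: "(\<lambda>k. y\<^sup>2 / 2 * (b / 3) ^ k) sums (y\<^sup>2 / 2 * (1 / (1 - b / 3)))"
    using assms b by (intro sums_mult geometric_sums) auto
  have le: "inverse (fact (k + 2)) *\<^sub>R y ^ (k + 2) \<le> y\<^sup>2 / 2 * (b / 3) ^ k" for k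
  proof -
    have "inverse (fact (k + 2)) *\<^sub>R y ^ (k + 2) = y\<^sup>2 * (y ^ k / fact (k + 2))"
      by (simp add: field_simps power_add power2_eq_square)
    also have "\<dots> \<le> y\<^sup>2 * (b ^ k / (2 * 3 ^ k))"
    proof (intro mult_left_mono frac_le)
      have "y ^ k \<le> \<bar>y\<bar> ^ k" by (metis abs_ge_self power_abs)
      also have "\<dots> \<le> b ^ k" using assms by (intro power_mono) auto
      finally show "y ^ k \<le> b ^ k" .
    qed (use b two_mult_three_power_le_fact in auto)
    also have "\<dots> = y\<^sup>2 / 2 * (b / 3) ^ k" by (simp add: power_divide)
    finally show ?thesis .
  qed
  have summable: "summable (\<lambda>k. inverse (fact (k + 2)) *\<^sub>R y ^ (k + 2))"
    using summable_exp_generic[of y] by (subst summable_iff_shift)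
  have "(\<Sum>k. inverse (fact (k + 2)) *\<^sub>R y ^ (k + 2)) \<le> y\<^sup>2 / 2 * (1 / (1 - b / 3))"
    using suminf_le[OF le summable sums_summable[OF sums]] unfolding sums_unique[OF sums] .
  then show ?thesis
    unfolding exp_first_two_terms[of y] by simp
qed

lemma (in prob_space) integrable_power_AE_bounded:
  fixes X :: "'a \<Rightarrow> real"
  assumes [measurable]: "random_variable borel X" and "AE x in M. \<bar>X x\<bar> \<le> C"
  shows "integrable M (\<lambda>x. X x ^ k)"
proof (rule integrable_const_bound)
  show "AE x in M. norm (X x ^ k) \<le> C ^ k"
    using assms(2) by eventually_elim (simp add: power_abs power_mono)
qed measurable

text \<open>\<open>exp_le_Bernstein\<close> is applied with \<open>y = l * X x\<close> and
  \<open>b = l * C\<close>. Under expectation the linear term vanishes, and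
  \<open>1 + u \<le> exp u\<close> restores an exponential, so that bounds for independent variables
  multiply by adding exponents.\<close>

lemma (in prob_space)
  fixes X :: "'a \<Rightarrow> real"
  assumes [measurable]: "random_variable borel X" and bound: "AE x in M. \<bar>X x\<bar> \<le> C"
    and mean: "expectation X = 0" and l: "0 \<le> l" "l * C < 3"
  shows Bernstein_mgf_integrable: "integrable M (\<lambda>x. exp (l * X x))"
    and Bernstein_mgf_le: "expectation (\<lambda>x. exp (l * X x))
           \<le> exp (l\<^sup>2 * expectation (\<lambda>x. (X x)\<^sup>2) / (2 * (1 - l * C / 3)))"
proof -
  show int: "integrable M (\<lambda>x. exp (l * X x))"
  proof (rule integrable_const_bound)
    show "AE x in M. norm (exp (l * X x)) \<le> exp (l * C)"
      using bound by eventually_elim (use l in \<open>auto intro!: mult_left_mono\<close>)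
  qed measurable
  have int1: "integrable M X" and int2: "integrable M (\<lambda>x. (X x)\<^sup>2)"
    using integrable_power_AE_bounded[OF assms(1) bound, of 1]
      integrable_power_AE_bounded[OF assms(1) bound, of 2] by simp_all
  define d where "d = l\<^sup>2 / (2 * (1 - l * C / 3))"
  have "expectation (\<lambda>x. exp (l * X x)) \<le> expectation (\<lambda>x. 1 + l * X x + d * (X x)\<^sup>2)"
  proof (rule integral_mono_AE[OF int])
    show "integrable M (\<lambda>x. 1 + l * X x + d * (X x)\<^sup>2)" using int1 int2 by simp
    show "AE x in M. exp (l * X x) \<le> 1 + l * X x + d * (X x)\<^sup>2"
      using bound
    proof eventually_elim
      case (elim x)
      have "\<bar>l * X x\<bar> \<le> l * C" using elim l by (simp add: abs_mult mult_left_mono)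
      from exp_le_Bernstein[OF this l(2)] show ?case
        by (simp add: d_def power_mult_distrib)
    qed
  qed
  also have "\<dots> = 1 + d * expectation (\<lambda>x. (X x)\<^sup>2)"
    using int1 int2 mean by (simp add: prob_space)
  also have "\<dots> \<le> exp (d * expectation (\<lambda>x. (X x)\<^sup>2))" by (rule exp_ge_add_one_self)
  finally show "expectation (\<lambda>x. exp (l * X x))
      \<le> exp (l\<^sup>2 * expectation (\<lambda>x. (X x)\<^sup>2) / (2 * (1 - l * C / 3)))"
    by (simp add: d_def)
qed

text \<open>Chernoff's method: Markov's inequality for \<open>exp (l * sum)\<close>, factorisation
  by independence, then the moment generating function bound. The tail is parametrised by its level
  \<open>t\<close>, ready for a union bound.\<close>

theorem (in prob_space) Bernstein_ineq:
  fixes X :: "'i \<Rightarrow> 'a \<Rightarrow> real"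
  assumes fin: "finite I" and indep: "indep_vars (\<lambda>_. borel) X I"
    and bound: "\<And>i. i \<in> I \<Longrightarrow> AE x in M. \<bar>X i x\<bar> \<le> C" and C: "0 \<le> C"
    and mean: "\<And>i. i \<in> I \<Longrightarrow> expectation (X i) = 0"
    and var: "(\<Sum>i\<in>I. expectation (\<lambda>x. (X i x)\<^sup>2)) \<le> V"
    and t: "0 < t"
  shows "prob {x \<in> space M. (\<Sum>i\<in>I. X i x) > C * t / 3 + sqrt (2 * V * t)} \<le> exp (- t)"
proof -
  have [measurable]: "random_variable borel (X i)" if "i \<in> I" for i
    using indep that unfolding indep_vars_def by blast
  have var_nonneg: "0 \<le> expectation (\<lambda>x. (X i x)\<^sup>2)" for i by simp
  have "0 \<le> (\<Sum>i\<in>I. expectation (\<lambda>x. (X i x)\<^sup>2))" by (intro sum_nonneg var_nonneg)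
  with var have "0 \<le> V" by linarith
  then consider "V = 0" | "0 < V" by fastforce
  then show ?thesis
  proof cases
    \<comment> \<open>Here the \<open>l\<close> of the other case would be 0 / 0. Instead every
      \<open>X i\<close> vanishes almost surely, and a zero sum cannot strictly exceed the
      nonnegative threshold.\<close>
    case 1
    have "AE x in M. X i x = 0" if i: "i \<in> I" for i
    proof -
      have "expectation (\<lambda>x. (X i x)\<^sup>2) \<le> (\<Sum>i\<in>I. expectation (\<lambda>x. (X i x)\<^sup>2))"
        using i fin var_nonneg by (intro member_le_sum)
      with 1 var var_nonneg[of i] have "expectation (\<lambda>x. (X i x)\<^sup>2) = 0" by linarith
      moreover have "integrable M (\<lambda>x. (X i x)\<^sup>2)"
        using i bound by (intro integrable_power_AE_bounded) auto
      ultimately show ?thesis by (simp add: integral_nonneg_eq_0_iff_AE)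
    qed
    with fin have "AE x in M. \<forall>i\<in>I. X i x = 0" by (simp add: AE_finite_all)
    then have "AE x in M. \<not> (\<Sum>i\<in>I. X i x) > C * t / 3 + sqrt (2 * V * t)"
      by eventually_elim (use 1 mult_nonneg_nonneg[OF C less_imp_le[OF t]] in simp)
    then have "prob {x \<in> space M. (\<Sum>i\<in>I. X i x) > C * t / 3 + sqrt (2 * V * t)} = 0"
      by (subst prob_eq_0) auto
    then show ?thesis by simp
  next
    case 2
    define s where "s = sqrt (2 * V * t)"
    define c where "c = C / 3"
    \<comment> \<open>\<open>l\<close> is chosen so that the Chernoff exponent
      \<open>l\<^sup>2 V / (2 (1 - l c)) - l (c t + s)\<close> equals \<open>- t\<close> exactly\<close>
    define l where "l = s / (V + c * s)"
    have s: "0 < s" "s\<^sup>2 = 2 * V * t" and c: "0 \<le> c"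
      using 2 t C by (auto simp: s_def c_def)
    have D: "0 < V + c * s" using 2 s c by (simp add: add_pos_nonneg)
    have l: "0 < l" using s D by (simp add: l_def)
    \<comment> \<open>Since \<open>V > 0\<close>, this quotient is positive, so the choice of
      \<open>l\<close> automatically respects the constraint \<open>l * C < 3\<close>.\<close>
    have lc: "1 - l * c = V / (V + c * s)" using D by (simp add: l_def field_simps)
    then have lc_pos: "0 < 1 - l * c" using 2 D by simp
    then have lC: "l * C < 3" by (simp add: c_def)
    have indep_exp: "indep_vars (\<lambda>_. borel) (\<lambda>i x. exp (l * X i x)) I"
      by (intro indep_vars_compose2[OF indep]) auto
    note mgf = Bernstein_mgf_integrable[OF _ bound mean less_imp_le[OF l] lC]
      Bernstein_mgf_le[OF _ bound mean less_imp_le[OF l] lC]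
    have int: "integrable M (\<lambda>x. \<Prod>i\<in>I. exp (l * X i x))"
      by (intro indep_vars_integrable fin indep_exp mgf(1)) auto
    have "prob {x \<in> space M. (\<Sum>i\<in>I. X i x) > c * t + s}
        \<le> prob {x \<in> space M. (\<Prod>i\<in>I. exp (l * X i x)) \<ge> exp (l * (c * t + s))}"
    proof (rule finite_measure_mono)
      show "{x \<in> space M. (\<Sum>i\<in>I. X i x) > c * t + s}
          \<subseteq> {x \<in> space M. (\<Prod>i\<in>I. exp (l * X i x)) \<ge> exp (l * (c * t + s))}"
        using l fin by (auto simp flip: exp_sum sum_distrib_left)
    qed measurable
    also have "\<dots> \<le> expectation (\<lambda>x. \<Prod>i\<in>I. exp (l * X i x)) / exp (l * (c * t + s))"
      by (rule integral_Markov_inequality_measure[OF int sets.empty_sets])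
        (auto intro!: prod_nonneg)
    also have "expectation (\<lambda>x. \<Prod>i\<in>I. exp (l * X i x)) = (\<Prod>i\<in>I. expectation (\<lambda>x. exp (l * X i x)))"
      by (intro indep_vars_lebesgue_integral fin indep_exp mgf(1)) auto
    also have "\<dots> \<le> (\<Prod>i\<in>I. exp (l\<^sup>2 * expectation (\<lambda>x. (X i x)\<^sup>2) / (2 * (1 - l * C / 3))))"
      by (intro prod_mono conjI mgf(2)) auto
    also have "\<dots> = exp (l\<^sup>2 * (\<Sum>i\<in>I. expectation (\<lambda>x. (X i x)\<^sup>2)) / (2 * (1 - l * c)))"
      using fin by (simp add: c_def sum_distrib_left sum_divide_distrib exp_sum)
    also have "\<dots> \<le> exp (l\<^sup>2 * V / (2 * (1 - l * c)))"
      using var lc_pos by (auto intro!: divide_right_mono mult_left_mono)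
    also have "\<dots> / exp (l * (c * t + s)) = exp (l\<^sup>2 * V / (2 * (1 - l * c)) - l * (c * t + s))"
      by (simp add: exp_diff)
    also have "l\<^sup>2 * V / (2 * (1 - l * c)) - l * (c * t + s) = - t"
    proof -
      have "l\<^sup>2 * V / (2 * (1 - l * c)) = l\<^sup>2 * (V + c * s) / 2"
        unfolding lc using 2 D by simp
      also have "\<dots> = s\<^sup>2 / (2 * (V + c * s))"
        using D by (simp add: l_def power_divide power2_eq_square)
      also have "\<dots> = V * t / (V + c * s)"
        unfolding s(2) by (simp only: mult.assoc mult_divide_mult_cancel_left_if) simp
      finally have "l\<^sup>2 * V / (2 * (1 - l * c)) - l * (c * t + s)
          = (V * t - (s * c * t + s\<^sup>2)) / (V + c * s)"
        by (simp add: l_def diff_divide_distrib power2_eq_square algebra_simps)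
      \<comment> \<open>With \<open>s^2 = 2 * V * t\<close> the numerator becomes
        \<open>- t * (V + c * s)\<close>, and the denominator cancels.\<close>
      also have "\<dots> = - t" using D unfolding s(2) by (simp add: field_simps)
      finally show ?thesis .
    qed
    finally show ?thesis by (simp add: c_def s_def divide_right_mono)
  qed
qed

theorem proposition5:
  fixes \<Omega> :: "'w measure"
    and MX :: "'x measure" and MY :: "'y measure"
    and P :: "('x \<times> 'y) measure"
    and L :: "'y \<Rightarrow> 'y \<Rightarrow> real"
    and F :: "('x \<Rightarrow> 'y) set"
    and Z :: "nat \<Rightarrow> 'w \<Rightarrow> 'x \<times> 'y"
    and m :: nat
    and \<gamma> C \<delta> :: real
  assumes "prob_space \<Omega>"
    and "prob_space P" and "sets P = sets (MX \<Otimes>\<^sub>M MY)"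
    and "m \<ge> 1" and "iid_draws \<Omega> P m Z"
    and "finite F" and "F \<noteq> {}" and "F \<subseteq> (space MX \<rightarrow>\<^sub>E space MY)"
    and "\<And>f. f \<in> F \<Longrightarrow> (\<lambda>(x, y). L (f x) y) \<in> borel_measurable P"
    and "\<And>f i. f \<in> F \<Longrightarrow> i \<in> {1..m} \<Longrightarrow>
           (\<integral>\<omega>. (kappa L P (\<lambda>j. Z j \<omega>) f i)\<^sup>2 \<partial>\<Omega>) \<le> \<gamma>\<^sup>2"
    and "\<And>f i. f \<in> F \<Longrightarrow> i \<in> {1..m} \<Longrightarrow>
           (AE \<omega> in \<Omega>. \<bar>kappa L P (\<lambda>j. Z j \<omega>) f i\<bar> \<le> C)"
    and "\<delta> > 0"
  shows "measure \<Omega> {\<omega> \<in> space \<Omega>. \<forall>f\<in>F.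
           expected_risk L P f \<le> empirical_risk L m (\<lambda>j. Z j \<omega>) f
             + 2 * C * ln (real (card F) / \<delta>) / (3 * real m)
             + sqrt (2 * \<gamma>\<^sup>2 * ln (real (card F) / \<delta>) / real m)} \<ge> 1 - \<delta>"
proof (cases "\<delta> < 1")
  \<comment> \<open>The claimed lower bound is at most 0 here. Treating this case apart matters
    because the logarithm need not be positive when \<open>\<delta> \<ge> 1\<close>.\<close>
  case False
  then show ?thesis by (simp add: order_trans[OF _ measure_nonneg])
next
  case True
  note meas = assms(9) and second_moment = assms(10) and bound = assms(11)
  interpret prob_space \<Omega> by fact
  interpret P: prob_space P by fact
  have indep: "indep_vars (\<lambda>_. P) Z {1..m}"
    and distr: "\<And>i. i \<in> {1..m} \<Longrightarrow> distr \<Omega> P (Z i) = P"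
    using assms(5) by (auto simp: iid_draws_def)
  have Z [measurable]: "Z i \<in> measurable \<Omega> P" if "i \<in> {1..m}" for i
    using indep that by (auto simp: indep_vars_def)
  define t where "t = ln (real (card F) / \<delta>)"
  \<comment> \<open>\<open>g f\<close> is the deviation as a function of a single draw. Writing
    \<open>\<kappa> f i\<close> as \<open>g f\<close> after \<open>Z i\<close> transfers
    measurability, independence and law from the draws.\<close>
  define g where "g f = (\<lambda>z. expected_risk L P f - (\<lambda>(x, y). L (f x) y) z)" for f
  define \<kappa> where "\<kappa> f i \<omega> = kappa L P (\<lambda>j. Z j \<omega>) f i" for f i \<omega>
  define B where "B f = {\<omega> \<in> space \<Omega>. (\<Sum>i = 1..m. \<kappa> f i \<omega>) > C * t / 3 + sqrt (2 * (m * \<gamma>\<^sup>2) * t)}"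
    for f
  have card: "1 \<le> card F" using assms(6,7) by (simp add: Suc_le_eq card_gt_0_iff)
  then have t: "0 < t" and exp_t: "card F * exp (- t) = \<delta>"
    using True \<open>0 < \<delta>\<close> by (auto simp: t_def exp_minus field_simps)
  have g [measurable]: "g f \<in> borel_measurable P" if "f \<in> F" for f
    unfolding g_def using meas[OF that] by measurable
  have \<kappa>_eq: "\<kappa> f i = (\<lambda>\<omega>. g f (Z i \<omega>))" for f i
    by (simp add: fun_eq_iff \<kappa>_def g_def kappa_def case_prod_beta)
  have \<kappa>_meas [measurable]: "\<kappa> f i \<in> borel_measurable \<Omega>" if "f \<in> F" "i \<in> {1..m}" for f i
    unfolding \<kappa>_eq using g[OF that(1)] Z[OF that(2)] by measurable
  \<comment> \<open>The almost sure bound at index 1 for some \<open>f\<close> in the nonempty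
    \<open>F\<close> would otherwise be contradictory on a probability space.\<close>
  have "\<not> C < 0"
  proof
    assume "C < 0"
    obtain f where "f \<in> F" using assms(7) by blast
    with assms(4) have "AE \<omega> in \<Omega>. \<bar>kappa L P (\<lambda>j. Z j \<omega>) f 1\<bar> \<le> C" by (intro bound) auto
    then have "AE \<omega> in \<Omega>. False"
      by eventually_elim (use \<open>C < 0\<close> in linarith)
    then show False by simp
  qed
  then have C: "0 \<le> C" by simp
  have B_sets: "B f \<in> sets \<Omega>" if "f \<in> F" for f
    unfolding B_def using that by measurable
  have B_le: "prob (B f) \<le> exp (- t)" if f: "f \<in> F" for f
    unfolding B_def
  proof (rule Bernstein_ineq)
    show "indep_vars (\<lambda>_. borel) (\<kappa> f) {1..m}"
      unfolding \<kappa>_eq[abs_def] using g[OF f] by (intro indep_vars_compose2[OF indep])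
    show "AE \<omega> in \<Omega>. \<bar>\<kappa> f i \<omega>\<bar> \<le> C" if "i \<in> {1..m}" for i
      using bound[OF f that] by (simp add: \<kappa>_def)
    \<comment> \<open>Integrability of the loss has to come first, since otherwise
      \<open>expected_risk\<close> would be the default value 0 and not a mean. It follows from the
      bound on \<open>\<kappa>\<close>, carried over to \<open>P\<close> along the law of
      \<open>Z i\<close>.\<close>
    show "expectation (\<kappa> f i) = 0" if i: "i \<in> {1..m}" for i
    proof -
      have "AE z in distr \<Omega> P (Z i). \<bar>g f z\<bar> \<le> C"
        using bound[OF f i] g[OF f] Z[OF i] unfolding \<kappa>_def[symmetric] \<kappa>_eq
        by (subst AE_distr_iff) auto
      then have "integrable P (g f)"
        using P.integrable_power_AE_bounded[of "g f" C 1] g[OF f] unfolding distr[OF i] by simp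
      then have "integrable P (\<lambda>z. expected_risk L P f - g f z)" by simp
      then have "integrable P (\<lambda>(x, y). L (f x) y)" by (simp add: g_def)
      then have "P.expectation (g f) = 0"
        by (simp add: g_def expected_risk_def P.prob_space)
      then show ?thesis
        using integral_distr[OF Z[OF i] g[OF f]] by (simp add: \<kappa>_eq distr[OF i])
    qed
    have "(\<Sum>i = 1..m. expectation (\<lambda>\<omega>. (\<kappa> f i \<omega>)\<^sup>2)) \<le> (\<Sum>i = 1..m. \<gamma>\<^sup>2)"
      using second_moment[OF f] by (intro sum_mono) (simp add: \<kappa>_def)
    then show "(\<Sum>i = 1..m. expectation (\<lambda>\<omega>. (\<kappa> f i \<omega>)\<^sup>2)) \<le> m * \<gamma>\<^sup>2" by simp
  qed (use C t in auto)
  have risk_le: "expected_risk L P f \<le> empirical_risk L m (\<lambda>j. Z j \<omega>) f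
      + 2 * C * t / (3 * real m) + sqrt (2 * \<gamma>\<^sup>2 * t / real m)"
    if "\<omega> \<in> space \<Omega>" "\<omega> \<notin> B f" for f \<omega>
  proof -
    have m: "0 < real m" using assms(4) by simp
    have "(\<Sum>i = 1..m. \<kappa> f i \<omega>)
        = m * (expected_risk L P f - empirical_risk L m (\<lambda>j. Z j \<omega>) f)"
      using m by (simp add: \<kappa>_def kappa_def empirical_risk_def sum_subtractf field_simps)
    with that have "m * (expected_risk L P f - empirical_risk L m (\<lambda>j. Z j \<omega>) f)
        \<le> C * t / 3 + sqrt (2 * (m * \<gamma>\<^sup>2) * t)"
      by (simp add: B_def not_less)
    \<comment> \<open>Half of the linear term is given away to reach the stated constant.\<close>
    also have "\<dots> \<le> 2 * C * t / 3 + sqrt (2 * (m * \<gamma>\<^sup>2) * t)"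
      using C t by simp
    also have "2 * (m * \<gamma>\<^sup>2) * t = (real m)\<^sup>2 * (2 * \<gamma>\<^sup>2 * t / m)"
      using m by (simp add: power2_eq_square)
    also have "sqrt \<dots> = m * sqrt (2 * \<gamma>\<^sup>2 * t / m)"
      by (simp only: real_sqrt_mult real_sqrt_abs abs_of_nat)
    also have "2 * C * t / 3 + m * sqrt (2 * \<gamma>\<^sup>2 * t / m)
        = m * (2 * C * t / (3 * m) + sqrt (2 * \<gamma>\<^sup>2 * t / m))"
      using m by (simp add: distrib_left)
    finally show ?thesis using m by (simp add: mult_le_cancel_left_pos)
  qed
  \<comment> \<open>This makes the final event measurable. Inclusion alone would not compare
    probabilities, as \<open>measure\<close> is 0 on non-measurable sets.\<close>
  have emp [measurable]: "(\<lambda>\<omega>. empirical_risk L m (\<lambda>j. Z j \<omega>) f) \<in> borel_measurable \<Omega>"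
    if f: "f \<in> F" for f
  proof -
    have "(\<lambda>\<omega>. (1 / m) * (\<Sum>i = 1..m. expected_risk L P f - \<kappa> f i \<omega>)) \<in> borel_measurable \<Omega>"
      using f by measurable
    then show ?thesis by (simp add: empirical_risk_def \<kappa>_def kappa_def)
  qed
  have "prob (\<Union>f\<in>F. B f) \<le> (\<Sum>f\<in>F. prob (B f))"
    using assms(6) B_sets by (intro finite_measure_subadditive_finite) auto
  also have "\<dots> \<le> (\<Sum>f\<in>F. exp (- t))" by (intro sum_mono B_le)
  \<comment> \<open>The level \<open>t\<close> was chosen so that \<open>card F\<close> failures of
    probability \<open>exp (- t)\<close> add up to exactly \<open>\<delta>\<close>.\<close>
  also have "\<dots> = \<delta>" using exp_t by simp
  finally have "1 - \<delta> \<le> prob (space \<Omega> - (\<Union>f\<in>F. B f))"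
    using assms(6) B_sets by (subst prob_compl) auto
  also have "\<dots> \<le> measure \<Omega> {\<omega> \<in> space \<Omega>. \<forall>f\<in>F.
      expected_risk L P f \<le> empirical_risk L m (\<lambda>j. Z j \<omega>) f
        + 2 * C * t / (3 * real m) + sqrt (2 * \<gamma>\<^sup>2 * t / real m)}"
  proof (rule finite_measure_mono)
    show "{\<omega> \<in> space \<Omega>. \<forall>f\<in>F. expected_risk L P f \<le> empirical_risk L m (\<lambda>j. Z j \<omega>) f
        + 2 * C * t / (3 * real m) + sqrt (2 * \<gamma>\<^sup>2 * t / real m)} \<in> sets \<Omega>"
      using assms(6) by measurable
  qed (use risk_le in auto)
  finally show ?thesis by (simp add: t_def)
qed

end
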